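(* Let $\mathcal X$ be a finite nonempty set of states, and let an imprecise Markov chain on $\mathcal X$ be given by an initial upper expectation functional $\overline E_0$ and an upper transition operator $\overline T$, with corresponding lower expectation functional $\underline E_0$ and lower transition operator $\underline T$. Let $r\ge 1$ be an integer with $\rho:=\rho(\overline T^r)<1$, and let $n=kr+m$ with integers $k\ge0$ and $0\le m<r$. Put $\overline E_n=\overline E_0\overline T^n$, $\underline E_n=\underline E_0\underline T^n$, $I_n=d(\overline E_n,\underline E_n)$, $\hat I_n=d(\overline T^n,\underline T^n)$, $\hat I=\hat I_1=d(\overline T,\underline T)$, and $I_\infty=d(\overline E_\infty,\underline E_\infty)$, where $\overline E_\infty,\underline E_\infty$ are the limit upper and lower expectation functionals of the chain. Then $$I_n\le I_0\,\rho^k+\hat I\left(r\,\frac{1-\rho^k}{1-\rho}+m\rho^k\right),$$ $$I_\infty\le\frac{\hat I\,r}{1-\rho},$$ $$\hat I_n\le\hat I_1\left(r\,\frac{1-\rho^k}{1-\rho}+m\rho^k\right).$$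
   Context: $\mathcal L(\mathcal X)$ is the space of all maps $f:\mathcal X\to\mathbb R$, and $\mathcal L_1=\{f\in\mathcal L(\mathcal X): 0\le f(x)\le 1\ \forall x\in\mathcal X\}$. An expectation functional is a map $E(f)=\sum_{x}p(x)f(x)$ with $p$ a probability mass function on $\mathcal X$. A credal set is a nonempty closed convex set $\mathcal M$ of expectation functionals; its upper and lower expectation functionals are $\overline E(f)=\max_{E\in\mathcal M}E(f)$ and $\underline E(f)=\min_{E\in\mathcal M}E(f)=-\overline E(-f)$. An upper transition operator is a map $\overline T:\mathcal L(\mathcal X)\to\mathcal L(\mathcal X)$, $\overline Tf(x)=\overline T(f|x)$, where for each $x\in\mathcal X$ the functional $\overline T(\cdot|x)$ is an upper expectation functional; the corresponding lower transition operator is $\underline Tf=-\overline T(-f)$, with rows $\underline T(\cdot|x)$. Products denote composition, $\overline T^0=\underline T^0$ is the identity, and $(\overline E\,\overline T^n)(f)=\overline E(\overline T^nf)$, etc. Distances: $d(\overline E_1,\overline E_2)=\max_{f\in\mathcal L_1}|\overline E_1(f)-\overline E_2(f)|$ for two upper expectation functionals; $d(\overline E_1,\underline E_2)=\max_{f\in\mathcal L_1}\big(\overline E_1(f)-\underline E_2(f)\big)$ for an upper and a lower expectation functional; $d(\overline T,\underline T)=\max_{x\in\mathcal X}d(\overline T(\cdot|x),\underline T(\cdot|x))$. Weak coefficient of ergodicity: $\rho(\overline T)=\max_{x,y\in\mathcal X}d(\overline T(\cdot|x),\overline T(\cdot|y))$. When $\rho(\overline T^r)<1$ for some $r\ge 1$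 the chain is uniquely convergent: the limits $\overline E_\infty(f)=\lim_n\overline E_n(f)$ and $\underline E_\infty(f)=\lim_n\underline E_n(f)$ exist for every $f$ and do not depend on the initial functional. Convention: $0^0=1$. *)

theory Defs
  imports "HOL-Analysis.Analysis" "HOL-Probability.Probability_Mass_Function"
begin

type_synonym 'a functional = "('a \<Rightarrow> real) \<Rightarrow> real"
type_synonym 'a operator = "('a \<Rightarrow> real) \<Rightarrow> ('a \<Rightarrow> real)"

definition L1 :: "('a \<Rightarrow> real) set" where
  "L1 = {f. \<forall>x. 0 \<le> f x \<and> f x \<le> 1}"

definition is_expectation :: "'a::finite functional \<Rightarrow> bool" where
  "is_expectation E \<longleftrightarrow> (\<exists>p :: 'a pmf. E = (\<lambda>f. \<Sum>x\<in>UNIV. pmf p x * f x))"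

(* Closedness refers to the product topology on functionals, i.e. pointwise convergence; on
   expectation functionals over a finite type it agrees with the Euclidean topology on mass
   functions. Convexity is written out because function types carry no real_vector instance. *)
definition credal_set :: "'a::finite functional set \<Rightarrow> bool" where
  "credal_set M \<longleftrightarrow> M \<noteq> {} \<and> (\<forall>E\<in>M. is_expectation E) \<and> closed M \<and>
     (\<forall>E\<in>M. \<forall>F\<in>M. \<forall>t. 0 \<le> t \<and> t \<le> 1 \<longrightarrow> (\<lambda>f. (1 - t) * E f + t * F f) \<in> M)"

(* For a credal set the supremum is a maximum: see upper_envelope_attained below. *)
definition upper_envelope :: "'a functional set \<Rightarrow> 'a functional" where
  "upper_envelope M f = (SUP E\<in>M. E f)"

definition is_upper_expectation :: "'a::finite functional \<Rightarrow> bool" where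
  "is_upper_expectation U \<longleftrightarrow> (\<exists>M. credal_set M \<and> U = upper_envelope M)"

(* The lower expectation functional belonging to an upper one; it is the minimum over the
   credal set: see lower_of_upper_envelope below. *)
definition lower_of :: "'a functional \<Rightarrow> 'a functional" where
  "lower_of U f = - U (\<lambda>x. - f x)"

definition is_upper_transition :: "'a::finite operator \<Rightarrow> bool" where
  "is_upper_transition T \<longleftrightarrow> (\<forall>x. is_upper_expectation (\<lambda>f. T f x))"

definition lower_transition :: "'a operator \<Rightarrow> 'a operator" where
  "lower_transition T f x = - T (\<lambda>y. - f y) x"

(* For upper expectation functionals the suprema over L1 in the next two definitions are maxima:
   see dist_upper_attained and dist_upper_lower_attained below. *)
definition dist_upper :: "'a functional \<Rightarrow> 'a functional \<Rightarrow> real" where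
  "dist_upper U V = (SUP f\<in>L1. \<bar>U f - V f\<bar>)"

definition dist_upper_lower :: "'a functional \<Rightarrow> 'a functional \<Rightarrow> real" where
  "dist_upper_lower U L = (SUP f\<in>L1. U f - L f)"

definition dist_transition :: "'a::finite operator \<Rightarrow> 'a operator \<Rightarrow> real" where
  "dist_transition T S = (MAX x. dist_upper_lower (\<lambda>f. T f x) (\<lambda>f. S f x))"

definition weak_ergodicity :: "'a::finite operator \<Rightarrow> real" where
  "weak_ergodicity T = (MAX (x, y). dist_upper (\<lambda>f. T f x) (\<lambda>f. T f y))"

definition functional_at :: "'a functional \<Rightarrow> 'a operator \<Rightarrow> nat \<Rightarrow> 'a functional" where
  "functional_at E T n = E \<circ> (T ^^ n)"

definition functional_limit :: "'a functional \<Rightarrow> 'a operator \<Rightarrow> 'a functional" where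
  "functional_limit E T f = lim (\<lambda>n. functional_at E T n f)"

lemma expectation_bounds:
  assumes "is_expectation E" "\<And>x. a \<le> f x" "\<And>x. f x \<le> b"
  shows "a \<le> E f" "E f \<le> b"
proof -
  obtain p :: "'a pmf" where p: "E = (\<lambda>f. \<Sum>x\<in>UNIV. pmf p x * f x)"
    using assms(1) by (auto simp: is_expectation_def)
  have 1: "(\<Sum>x\<in>UNIV. pmf p x) = 1"
    by (rule sum_pmf_eq_1) auto
  have "(\<Sum>x\<in>UNIV. pmf p x * a) \<le> E f" "E f \<le> (\<Sum>x\<in>UNIV. pmf p x * b)"
    unfolding p by (auto intro!: sum_mono mult_left_mono assms)
  then show "a \<le> E f" "E f \<le> b"
    using 1 by (simp_all flip: sum_distrib_right)
qed

lemma expectation_linear: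
  assumes "is_expectation E"
  shows "E (\<lambda>x. f x - g x) = E f - E g" "E (\<lambda>x. - f x) = - E f"
  using assms by (auto simp: is_expectation_def sum_subtractf sum_negf algebra_simps)

lemma compact_box: "compact {h :: 'b \<Rightarrow> real. \<forall>i. a i \<le> h i \<and> h i \<le> b i}"
proof -
  have "compactin (product_topology (\<lambda>_. euclidean) UNIV) (PiE UNIV (\<lambda>i. {a i..b i}))"
    by (auto simp: compactin_PiE)
  moreover have "PiE UNIV (\<lambda>i. {a i..b i}) = {h. \<forall>i. a i \<le> h i \<and> h i \<le> b i}"
    by (auto simp: PiE_iff)
  ultimately show ?thesis
    by (simp add: euclidean_product_topology)
qed

lemma credal_set_compact:
  fixes M :: "'a::finite functional set"
  assumes M: "credal_set M"
  shows "compact M"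
proof -
  let ?B = "{E :: 'a functional. \<forall>f. - (\<Sum>x\<in>UNIV. \<bar>f x\<bar>) \<le> E f \<and> E f \<le> (\<Sum>x\<in>UNIV. \<bar>f x\<bar>)}"
  have *: "\<bar>f x\<bar> \<le> (\<Sum>x\<in>UNIV. \<bar>f x\<bar>)" for f :: "'a \<Rightarrow> real" and x
    by (rule member_le_sum) auto
  have "M \<subseteq> ?B"
  proof safe
    fix E :: "'a functional" and f :: "'a \<Rightarrow> real" assume "E \<in> M"
    then have E: "is_expectation E" using M by (auto simp: credal_set_def)
    have "- (\<Sum>x\<in>UNIV. \<bar>f x\<bar>) \<le> f x" "f x \<le> (\<Sum>x\<in>UNIV. \<bar>f x\<bar>)" for x
      using *[of f x] by linarith+
    from expectation_bounds[OF E this]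
    show "- (\<Sum>x\<in>UNIV. \<bar>f x\<bar>) \<le> E f" "E f \<le> (\<Sum>x\<in>UNIV. \<bar>f x\<bar>)" by auto
  qed
  moreover have "compact ?B" by (rule compact_box)
  ultimately show ?thesis
    using M closed_Int_compact[of M ?B] by (auto simp: credal_set_def Int_absorb2)
qed

lemma upper_envelope_attained:
  assumes "credal_set M"
  shows "\<exists>E\<in>M. upper_envelope M f = E f \<and> (\<forall>F\<in>M. F f \<le> E f)"
proof -
  have "\<exists>E\<in>M. \<forall>F\<in>M. F f \<le> E f"
    using assms credal_set_compact[OF assms]
    by (intro continuous_attains_sup)
       (auto simp: credal_set_def intro: continuous_on_subset[OF continuous_on_product_coordinates])
  then obtain E where E: "E \<in> M" "\<And>F. F \<in> M \<Longrightarrow> F f \<le> E f" by blast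
  then have "upper_envelope M f = E f"
    unfolding upper_envelope_def by (intro cSup_eq_maximum) auto
  with E show ?thesis by blast
qed

lemma lower_of_upper_envelope:
  assumes "credal_set M"
  shows "\<exists>E\<in>M. lower_of (upper_envelope M) f = E f \<and> (\<forall>F\<in>M. E f \<le> F f)"
proof -
  obtain E where E: "E \<in> M" "upper_envelope M (\<lambda>x. - f x) = E (\<lambda>x. - f x)"
      "\<And>F. F \<in> M \<Longrightarrow> F (\<lambda>x. - f x) \<le> E (\<lambda>x. - f x)"
    using upper_envelope_attained[OF assms] by meson
  have neg: "F (\<lambda>x. - f x) = - F f" if "F \<in> M" for F
    using that assms by (intro expectation_linear) (auto simp: credal_set_def)
  have "lower_of (upper_envelope M) f = E f"
    using E(2) neg[OF E(1)] by (simp add: lower_of_def)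
  moreover have "E f \<le> F f" if "F \<in> M" for F
    using E(3)[OF that] neg[OF that] neg[OF E(1)] by simp
  ultimately show ?thesis using E(1) by blast
qed

lemma upper_expectation_Lipschitz:
  assumes "is_upper_expectation U"
  shows "\<bar>U f - U g\<bar> \<le> (\<Sum>x\<in>UNIV. \<bar>f x - g x\<bar>)"
proof -
  obtain M where M: "credal_set M" "U = upper_envelope M"
    using assms by (auto simp: is_upper_expectation_def)
  have "U f - U g \<le> (\<Sum>x\<in>UNIV. \<bar>f x - g x\<bar>)" for f g
  proof -
    obtain E where E: "E \<in> M" "U f = E f" using upper_envelope_attained M by metis
    obtain F where F: "U g = F g" "\<forall>G\<in>M. G g \<le> F g" using upper_envelope_attained M by metis
    have ex: "is_expectation E" using E M by (auto simp: credal_set_def)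
    have "U f - U g \<le> E f - E g" using E F by auto
    also have "\<dots> = E (\<lambda>x. f x - g x)" by (simp add: expectation_linear[OF ex])
    also have "\<dots> \<le> (\<Sum>x\<in>UNIV. \<bar>f x - g x\<bar>)"
    proof (rule expectation_bounds(2)[OF ex])
      show "f x - g x \<le> (\<Sum>x\<in>UNIV. \<bar>f x - g x\<bar>)" for x
        using member_le_sum[of x UNIV "\<lambda>x. \<bar>f x - g x\<bar>"] by auto
      show "- (\<Sum>x\<in>UNIV. \<bar>f x - g x\<bar>) \<le> f x - g x" for x
        using member_le_sum[of x UNIV "\<lambda>x. \<bar>f x - g x\<bar>"] by auto
    qed
    finally show ?thesis .
  qed
  from this[of f g] this[of g f] show ?thesis
    by (auto simp: abs_le_iff abs_minus_commute)
qed

lemma upper_expectation_continuous: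
  assumes "is_upper_expectation U"
  shows "continuous_on UNIV U"
  unfolding continuous_on_def
proof safe
  fix f :: "'a \<Rightarrow> real"
  have "((\<lambda>g. g x) \<longlongrightarrow> f x) (at f)" for x
    using continuous_on_product_coordinates[of x] by (auto simp: continuous_on_def)
  then have "((\<lambda>g. \<Sum>x\<in>UNIV. \<bar>g x - f x\<bar>) \<longlongrightarrow> (\<Sum>x\<in>UNIV. \<bar>f x - f x\<bar>)) (at f)"
    by (intro tendsto_intros)
  then have "((\<lambda>g. \<Sum>x\<in>UNIV. \<bar>g x - f x\<bar>) \<longlongrightarrow> 0) (at f)" by simp
  then have "((\<lambda>g. U g - U f) \<longlongrightarrow> 0) (at f)"
    by (rule Lim_null_comparison[rotated])
       (use upper_expectation_Lipschitz[OF assms] in auto)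
  then show "(U \<longlongrightarrow> U f) (at f)" by (simp add: LIM_zero_iff)
qed

lemma L1_attains_sup:
  fixes h :: "('a \<Rightarrow> real) \<Rightarrow> real"
  assumes "continuous_on UNIV h"
  shows "\<exists>f\<in>L1. (SUP g\<in>L1. h g) = h f \<and> (\<forall>g\<in>L1. h g \<le> h f)"
proof -
  have "compact (L1 :: ('a \<Rightarrow> real) set)" unfolding L1_def by (rule compact_box)
  moreover have "(\<lambda>_. 0) \<in> L1" by (simp add: L1_def)
  ultimately have "\<exists>f\<in>L1. \<forall>g\<in>L1. h g \<le> h f"
    using continuous_on_subset[OF assms] by (intro continuous_attains_sup) auto
  then obtain f where f: "f \<in> L1" "\<And>g. g \<in> L1 \<Longrightarrow> h g \<le> h f" by blast
  then have "(SUP g\<in>L1. h g) = h f" by (intro cSup_eq_maximum) auto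
  with f show ?thesis by blast
qed

lemma dist_upper_attained:
  assumes "is_upper_expectation U" "is_upper_expectation V"
  shows "\<exists>f\<in>L1. dist_upper U V = \<bar>U f - V f\<bar> \<and> (\<forall>g\<in>L1. \<bar>U g - V g\<bar> \<le> \<bar>U f - V f\<bar>)"
  unfolding dist_upper_def
  by (intro L1_attains_sup continuous_intros assms[THEN upper_expectation_continuous])

lemma dist_upper_lower_attained:
  assumes "is_upper_expectation U" "is_upper_expectation V"
  shows "\<exists>f\<in>L1. dist_upper_lower U (lower_of V) = U f - lower_of V f \<and>
           (\<forall>g\<in>L1. U g - lower_of V g \<le> U f - lower_of V f)"
proof -
  have "continuous_on UNIV (\<lambda>f :: 'a \<Rightarrow> real. \<lambda>x. - f x)"
    by (intro continuous_on_coordinatewise_then_product continuous_intros) auto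
  then have "continuous_on UNIV (lower_of V)"
    unfolding lower_of_def [abs_def]
    by (intro continuous_intros continuous_on_compose2[OF upper_expectation_continuous[OF assms(2)]]) auto
  then show ?thesis unfolding dist_upper_lower_def
    by (intro L1_attains_sup continuous_on_diff upper_expectation_continuous[OF assms(1)])
qed

end

theory Submission
  imports Defs
begin

text \<open>
  The imprecision of the chain is driven by one inequality. For an upper expectation functional
  \<open>U\<close> let \<open>width U\<close> be its distance to its own lower functional. For every \<open>f\<close> in \<open>L1\<close>, the gap
  of \<open>U\<close> composed with \<open>T\<close> splits at the intermediate value \<open>lower_of U (T f)\<close>: the first part is the
  gap of \<open>U\<close> at the single function \<open>T f\<close>, the second is a difference of \<open>lower_of U\<close> at \<open>T f\<close> and
  at \<open>lower_transition T f\<close>. The first part is at most \<open>width U\<close> times the oscillation of \<open>T f\<close>, which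
  is at most the ergodicity coefficient of \<open>T\<close>; the second is at most the distance of \<open>T\<close> and \<open>lower_transition T\<close>,
  because no value of \<open>U\<close> exceeds the maximum of its argument. This is lemma \<open>width_comp\<close>.

  As the ergodicity coefficient of \<open>T\<close> is at most 1, a single step adds at most this distance, say
  \<open>c\<close>, to the imprecision, so \<open>r\<close> steps of a
  chain without initial imprecision produce at most \<open>r c\<close>. Applying the inequality to \<open>T ^^ r\<close>
  then shows that \<open>r\<close> steps shrink the present imprecision by the factor \<open>\<rho>\<close> and add at most \<open>r c\<close>.
  Summing a geometric series (lemma \<open>affine_recursion_bound\<close>) gives the bounds for the chain, and,
  started from the point evaluations, which have no imprecision, the bounds for the powers of \<open>T\<close>.

  The values \<open>U (T ^^ n f)\<close> stay between the minimum and the maximum of \<open>T ^^ N f\<close> for \<open>n \<ge> N\<close>,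
  and these approach each other geometrically along multiples of \<open>r\<close>; so the limit functionals
  exist, and the bound on their distance is inherited from the finite bounds.
\<close>

section \<open>Coherent functionals and operators\<close>

text \<open>
  The sublinear functionals bounded by the maximum of their argument. Unlike representability
  by a credal set, these properties visibly survive composition with a transition operator, so
  the rows of \<open>T ^^ n\<close> and the functionals of later times are covered as well.
\<close>

definition coherent :: "'a functional \<Rightarrow> bool" where
  "coherent U \<longleftrightarrow> (\<forall>f g. U (\<lambda>x. f x + g x) \<le> U f + U g) \<and>
     (\<forall>f c. 0 \<le> c \<longrightarrow> U (\<lambda>x. c * f x) = c * U f) \<and>
     (\<forall>f b. (\<forall>x. f x \<le> b) \<longrightarrow> U f \<le> b)"

definition coherent_operator :: "'a operator \<Rightarrow> bool" where
  "coherent_operator T \<longleftrightarrow> (\<forall>x. coherent (\<lambda>f. T f x))"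

lemma coherentD:
  assumes "coherent U"
  shows coherent_add: "U (\<lambda>x. f x + g x) \<le> U f + U g"
    and coherent_scale: "0 \<le> c \<Longrightarrow> U (\<lambda>x. c * f x) = c * U f"
    and coherent_le: "(\<And>x. f x \<le> b) \<Longrightarrow> U f \<le> b"
  using assms by (auto simp: coherent_def)

lemma upper_expectation_coherent:
  assumes "is_upper_expectation U"
  shows "coherent U"
proof -
  obtain M where M: "credal_set M" "U = upper_envelope M"
    using assms by (auto simp: is_upper_expectation_def)
  have ex: "is_expectation E" if "E \<in> M" for E
    using that M by (auto simp: credal_set_def)
  have add: "E (\<lambda>x. f x + g x) = E f + E g" and scale: "E (\<lambda>x. c * f x) = c * E f"
    if "E \<in> M" for E f g c
    using ex[OF that]
    by (auto simp: is_expectation_def algebra_simps sum.distrib sum_distrib_left)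
  have att: "\<exists>E\<in>M. U f = E f \<and> (\<forall>F\<in>M. F f \<le> U f)" for f
    using upper_envelope_attained[OF M(1), of f] M(2) by auto
  show ?thesis unfolding coherent_def
  proof (intro conjI allI impI)
    fix f g :: "'a \<Rightarrow> real"
    obtain E where E: "E \<in> M" "U (\<lambda>x. f x + g x) = E (\<lambda>x. f x + g x)"
      using att by blast
    have "E f \<le> U f" "E g \<le> U g" using att E(1) by blast+
    then show "U (\<lambda>x. f x + g x) \<le> U f + U g"
      using E add[OF E(1), of f g] by linarith
  next
    fix f :: "'a \<Rightarrow> real" and c :: real assume c: "0 \<le> c"
    obtain E where E: "E \<in> M" "U f = E f" using att by blast
    obtain F where F: "F \<in> M" "U (\<lambda>x. c * f x) = F (\<lambda>x. c * f x)" using att by blast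
    have "F f \<le> U f" using att F(1) by blast
    then have "U (\<lambda>x. c * f x) \<le> c * U f"
      using F scale[OF F(1), of c f] c by (simp add: mult_left_mono)
    moreover have "E (\<lambda>x. c * f x) \<le> U (\<lambda>x. c * f x)" using att E(1) by blast
    then have "c * U f \<le> U (\<lambda>x. c * f x)" using E scale[OF E(1), of c f] by simp
    ultimately show "U (\<lambda>x. c * f x) = c * U f" by simp
  next
    fix f :: "'a \<Rightarrow> real" and b assume b: "\<forall>x. f x \<le> b"
    obtain E where E: "E \<in> M" "U f = E f" using att by blast
    have "Min (range f) \<le> f x" for x by simp
    then show "U f \<le> b" using expectation_bounds(2)[OF ex[OF E(1)]] b E(2) by metis
  qed
qed

lemma coherent_zero:
  assumes "coherent U"
  shows "U (\<lambda>x. 0) = 0"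
  using coherent_scale[OF assms, of 0 "\<lambda>x. 0"] by simp

lemma coherent_ge:
  assumes "coherent U" "\<And>x. a \<le> f x"
  shows "a \<le> U f"
proof -
  have "U (\<lambda>x. f x + - f x) \<le> U f + U (\<lambda>x. - f x)"
    by (rule coherent_add[OF assms(1)])
  moreover have "U (\<lambda>x. - f x) \<le> - a"
    using assms(2) by (intro coherent_le[OF assms(1)]) simp
  ultimately show ?thesis using coherent_zero[OF assms(1)] by simp
qed

lemma coherent_sub_le:
  assumes "coherent U"
  shows "U f - U g \<le> U (\<lambda>x. f x - g x)"
  using coherent_add[OF assms, of g "\<lambda>x. f x - g x"] by simp

lemma coherent_mono:
  assumes "coherent U" "\<And>x. f x \<le> g x"
  shows "U f \<le> U g"
proof -
  have "U (\<lambda>x. f x - g x) \<le> 0"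
    using assms(2) by (intro coherent_le[OF assms(1)]) simp
  then show ?thesis using coherent_sub_le[OF assms(1), of f g] by linarith
qed

lemma coherent_affine:
  assumes "coherent U" "0 \<le> s"
  shows "U (\<lambda>x. a + s * h x) = a + s * U h"
proof -
  have "U (\<lambda>x. a + s * h x) \<le> U (\<lambda>x. a) + U (\<lambda>x. s * h x)"
    by (rule coherent_add[OF assms(1)])
  moreover have "U (\<lambda>x. a) \<le> a" by (rule coherent_le[OF assms(1)]) simp
  moreover have "U (\<lambda>x. s * h x) \<le> U (\<lambda>x. - a) + U (\<lambda>x. a + s * h x)"
    using coherent_add[OF assms(1), of "\<lambda>x. - a" "\<lambda>x. a + s * h x"] by simp
  moreover have "U (\<lambda>x. - a) \<le> - a" by (rule coherent_le[OF assms(1)]) simp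
  ultimately show ?thesis using coherent_scale[OF assms(1,2), of h] by linarith
qed

lemma coherent_comp:
  assumes U: "coherent U" and T: "coherent_operator T"
  shows "coherent (U \<circ> T)"
  unfolding coherent_def
proof (intro conjI allI impI)
  have T': "coherent (\<lambda>f. T f x)" for x
    using T by (simp add: coherent_operator_def)
  fix f g :: "'a \<Rightarrow> real" and b c :: real
  have "U (T (\<lambda>x. f x + g x)) \<le> U (\<lambda>x. T f x + T g x)"
    by (intro coherent_mono[OF U] coherent_add[OF T'])
  also have "\<dots> \<le> U (T f) + U (T g)" by (rule coherent_add[OF U])
  finally show "(U \<circ> T) (\<lambda>x. f x + g x) \<le> (U \<circ> T) f + (U \<circ> T) g" by simp
  show "(U \<circ> T) (\<lambda>x. c * f x) = c * (U \<circ> T) f" if "0 \<le> c"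
  proof -
    have "T (\<lambda>x. c * f x) = (\<lambda>x. c * T f x)"
      by (rule ext) (rule coherent_scale[OF T' that])
    then show ?thesis by (simp add: coherent_scale[OF U that])
  qed
  show "(U \<circ> T) f \<le> b" if "\<forall>x. f x \<le> b"
    unfolding comp_def using that by (intro coherent_le[OF U] coherent_le[OF T']) simp
qed

lemma coherent_operator_power:
  assumes "coherent_operator T"
  shows "coherent_operator (T ^^ n)"
proof (induction n)
  case 0
  show ?case by (auto simp: coherent_operator_def coherent_def)
next
  case (Suc n)
  have "coherent ((\<lambda>f. (T ^^ n) f x) \<circ> T)" for x
    using Suc assms by (intro coherent_comp) (simp_all add: coherent_operator_def)
  then show ?case
    by (simp only: coherent_operator_def funpow_Suc_right comp_def) simp
qed

section \<open>Lower functionals of composed operators\<close>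

text \<open>
  Passing to the lower operator is conjugation with the sign change, an involution; inside a
  composition the signs cancel.
\<close>

lemma lower_transition_power: "lower_transition T ^^ n = lower_transition (T ^^ n)"
proof (induction n)
  case 0
  show ?case by (auto simp: lower_transition_def fun_eq_iff)
next
  case (Suc n)
  then show ?case by (simp add: lower_transition_def fun_eq_iff)
qed

lemma lower_transition_row: "(\<lambda>f. lower_transition T f x) = lower_of (\<lambda>f. T f x)"
  by (simp add: lower_transition_def lower_of_def fun_eq_iff)

lemma functional_at_lower:
  "functional_at (lower_of E) (lower_transition T) n = lower_of (functional_at E T n)"
  by (simp add: functional_at_def lower_of_def lower_transition_def lower_transition_power
      fun_eq_iff)

section \<open>Imprecision and oscillation\<close>

definition width :: "'a functional \<Rightarrow> real" where
  "width U = dist_upper_lower U (lower_of U)"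

lemma width_upper:
  assumes U: "coherent U" and f: "f \<in> L1"
  shows "U f - lower_of U f \<le> width U"
proof -
  have "U g - lower_of U g \<le> 1" if "g \<in> L1" for g
  proof -
    have "U g \<le> 1" using that by (intro coherent_le[OF U]) (simp add: L1_def)
    moreover have "U (\<lambda>x. - g x) \<le> 0" using that by (intro coherent_le[OF U]) (simp add: L1_def)
    ultimately show ?thesis by (simp add: lower_of_def)
  qed
  then have "bdd_above ((\<lambda>g. U g - lower_of U g) ` L1)" by (auto intro!: bdd_aboveI2)
  then show ?thesis unfolding width_def dist_upper_lower_def using f by (intro cSUP_upper)
qed

lemma zero_in_L1: "(\<lambda>x. 0) \<in> L1"
  by (simp add: L1_def)

lemma width_least:
  assumes "\<And>f. f \<in> L1 \<Longrightarrow> U f - lower_of U f \<le> b"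
  shows "width U \<le> b"
  unfolding width_def dist_upper_lower_def using assms zero_in_L1 by (intro cSUP_least) auto

lemma width_nonneg:
  assumes "coherent U"
  shows "0 \<le> width U"
  using width_upper[OF assms zero_in_L1] by (simp add: lower_of_def coherent_zero[OF assms])

text \<open>
  Both contraction estimates below come from this rescaling: additive constants pass through a
  coherent functional and nonnegative factors can be pulled out.
\<close>

lemma oscillation_rescale:
  fixes g :: "'a::finite \<Rightarrow> real"
  assumes "\<And>x y. g x - g y \<le> s"
  obtains a h where "h \<in> L1" "g = (\<lambda>x. a + s * h x)"
proof
  let ?a = "Min (range g)"
  let ?h = "\<lambda>x. if s = 0 then 0 else (g x - ?a) / s"
  have s: "0 \<le> s" using assms[of undefined undefined] by simp
  obtain y where y: "g y = ?a" using Min_in[of "range g"] by (metis UNIV_not_empty finite finite_imageI image_is_empty imageE)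
  have lo: "?a \<le> g x" for x by simp
  have hi: "g x - ?a \<le> s" for x using assms[of x y] y by simp
  show "?h \<in> L1" using s lo hi by (auto simp: L1_def divide_simps)
  show "g = (\<lambda>x. ?a + s * ?h x)"
  proof
    fix x
    show "g x = ?a + s * ?h x" using antisym[OF _ lo[of x]] hi[of x] by (cases "s = 0") simp_all
  qed
qed

lemma width_scale:
  fixes U :: "'a::finite functional"
  assumes U: "coherent U" and osc: "\<And>x y. g x - g y \<le> s"
  shows "U g - lower_of U g \<le> width U * s"
proof -
  have s: "0 \<le> s" using osc[of undefined undefined] by simp
  obtain a h where h: "h \<in> L1" and g: "g = (\<lambda>x. a + s * h x)"
    by (rule oscillation_rescale[of g s, OF osc])
  have "U g = a + s * U h" unfolding g by (rule coherent_affine[OF U s])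
  moreover have "U (\<lambda>x. - g x) = - a + s * U (\<lambda>x. - h x)"
    using coherent_affine[OF U s, of "- a" "\<lambda>x. - h x"] unfolding g by (simp add: algebra_simps)
  ultimately have "U g - lower_of U g = s * (U h - lower_of U h)"
    by (simp add: lower_of_def algebra_simps)
  also have "\<dots> \<le> s * width U" by (intro mult_left_mono width_upper[OF U h] s)
  finally show ?thesis by (simp add: mult.commute)
qed

lemma coherent_L1_diff_le_1:
  assumes "coherent U" "coherent V" "f \<in> L1"
  shows "\<bar>U f - V f\<bar> \<le> 1"
proof -
  have f: "0 \<le> f x" "f x \<le> 1" for x using assms(3) by (simp_all add: L1_def)
  show ?thesis
    using coherent_ge[of U 0 f, OF assms(1) f(1)] coherent_le[of U f 1, OF assms(1) f(2)]
      coherent_ge[of V 0 f, OF assms(2) f(1)] coherent_le[of V f 1, OF assms(2) f(2)] by linarith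
qed

lemma dist_upper_ge:
  assumes "coherent U" "coherent V" "f \<in> L1"
  shows "\<bar>U f - V f\<bar> \<le> dist_upper U V"
  unfolding dist_upper_def
  by (intro cSUP_upper assms(3) bdd_aboveI2[where M = 1] coherent_L1_diff_le_1[OF assms(1,2)])

lemma dist_upper_le_1:
  assumes "coherent U" "coherent V"
  shows "dist_upper U V \<le> 1"
  unfolding dist_upper_def using zero_in_L1 coherent_L1_diff_le_1[OF assms]
  by (intro cSUP_least) auto

lemma dist_upper_le_weak_ergodicity:
  fixes T :: "'a::finite operator"
  shows "dist_upper (\<lambda>f. T f x) (\<lambda>f. T f y) \<le> weak_ergodicity T"
  unfolding weak_ergodicity_def by (rule Max_ge) (auto intro: rev_image_eqI[of "(x, y)"])

lemma weak_ergodicity_nonneg: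
  assumes "coherent_operator T"
  shows "0 \<le> weak_ergodicity T"
proof -
  have c: "coherent (\<lambda>f. T f undefined)" using assms by (simp add: coherent_operator_def)
  show ?thesis
    using dist_upper_ge[OF c c zero_in_L1] dist_upper_le_weak_ergodicity[of T undefined undefined]
    by simp
qed

lemma weak_ergodicity_le_1:
  fixes T :: "'a::finite operator"
  assumes "coherent_operator T"
  shows "weak_ergodicity T \<le> 1"
  unfolding weak_ergodicity_def
  using assms by (subst Max_le_iff) (auto intro!: dist_upper_le_1 simp: coherent_operator_def)

lemma oscillation_contraction:
  fixes T :: "'a::finite operator"
  assumes T: "coherent_operator T" and osc: "\<And>x y. g x - g y \<le> s"
  shows "T g x - T g y \<le> weak_ergodicity T * s"
proof -
  have c: "coherent (\<lambda>f. T f z)" for z using T by (simp add: coherent_operator_def)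
  have s: "0 \<le> s" using osc[of undefined undefined] by simp
  obtain a h where h: "h \<in> L1" and g: "g = (\<lambda>x. a + s * h x)"
    by (rule oscillation_rescale[of g s, OF osc])
  have "T g z = a + s * T h z" for z unfolding g by (rule coherent_affine[OF c s])
  then have "T g x - T g y = s * (T h x - T h y)" by (simp add: algebra_simps)
  also have "\<dots> \<le> s * weak_ergodicity T"
    using dist_upper_ge[OF c[of x] c[of y] h] dist_upper_le_weak_ergodicity[of T x y]
    by (intro mult_left_mono s) linarith
  finally show ?thesis by (simp add: mult.commute)
qed

section \<open>Propagation of imprecision\<close>

abbreviation imprecision :: "'a::finite operator \<Rightarrow> real" where
  "imprecision T \<equiv> dist_transition T (lower_transition T)"

lemma imprecision_eq_Max_width: "imprecision T = (MAX x. width (\<lambda>f. T f x))"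
  by (simp add: dist_transition_def lower_transition_row width_def)

lemma width_row_le_imprecision: "width (\<lambda>f. T f x) \<le> imprecision T"
  unfolding imprecision_eq_Max_width by simp

lemma imprecision_least:
  assumes "\<And>x. width (\<lambda>f. T f x) \<le> b"
  shows "imprecision T \<le> b"
  unfolding imprecision_eq_Max_width using assms by simp

text \<open>
  Old imprecision is damped by the mixing of \<open>T\<close>, and \<open>T\<close> contributes its own: the intermediate
  value \<open>lower_of U (T f)\<close> separates the imprecision of \<open>U\<close> from that of \<open>T\<close>.
\<close>

lemma width_comp:
  fixes U :: "'a::finite functional"
  assumes U: "coherent U" and T: "coherent_operator T"
  shows "width (U \<circ> T) \<le> width U * weak_ergodicity T + imprecision T"
proof (rule width_least)
  fix f :: "'a \<Rightarrow> real" assume f: "f \<in> L1"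
  let ?S = "lower_transition T"
  have "0 \<le> f x" "f x \<le> 1" for x using f by (simp_all add: L1_def)
  then have "f x - f y \<le> 1" for x y using diff_mono[of "f x" 1 0 "f y"] by simp
  then have "T f x - T f y \<le> weak_ergodicity T" for x y
    using oscillation_contraction[OF T, of f 1 x y] by simp
  then have "U (T f) - lower_of U (T f) \<le> width U * weak_ergodicity T"
    by (rule width_scale[OF U, of "T f"])
  moreover have "lower_of U (T f) - lower_of U (?S f) \<le> imprecision T"
  proof -
    have "lower_of U (T f) - lower_of U (?S f) \<le> U (\<lambda>x. T f x - ?S f x)"
      using coherent_sub_le[OF U, of "\<lambda>x. - ?S f x" "\<lambda>x. - T f x"] by (simp add: lower_of_def)
    also have "\<dots> \<le> imprecision T"
    proof (rule coherent_le[OF U])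
      fix x
      have "coherent (\<lambda>f. T f x)" using T by (simp add: coherent_operator_def)
      from width_upper[OF this f] width_row_le_imprecision[of T x]
      show "T f x - ?S f x \<le> imprecision T"
        by (simp add: lower_of_def lower_transition_def)
    qed
    finally show ?thesis .
  qed
  moreover have "lower_of U (?S f) = lower_of (U \<circ> T) f"
    by (simp add: lower_of_def lower_transition_def)
  ultimately show "(U \<circ> T) f - lower_of (U \<circ> T) f
      \<le> width U * weak_ergodicity T + imprecision T" by simp
qed

lemma functional_at_add: "functional_at E T (a + b) = functional_at E T a \<circ> (T ^^ b)"
  by (simp add: functional_at_def funpow_add comp_assoc)

lemma functional_at_0: "functional_at E T 0 = E"
  by (simp add: functional_at_def)

lemma coherent_functional_at:
  assumes "coherent E" "coherent_operator T"
  shows "coherent (functional_at E T n)"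
  unfolding functional_at_def by (intro coherent_comp assms coherent_operator_power)

lemma width_step:
  fixes T :: "'a::finite operator"
  assumes E: "coherent E" and T: "coherent_operator T"
  shows "width (functional_at E T (Suc j)) \<le> width (functional_at E T j) + imprecision T"
proof -
  let ?U = "functional_at E T j"
  have U: "coherent ?U" by (rule coherent_functional_at[OF E T])
  have "width (functional_at E T (Suc j)) \<le> width ?U * weak_ergodicity T + imprecision T"
    using width_comp[OF U T] functional_at_add[of E T j 1] by simp
  moreover have "width ?U * weak_ergodicity T \<le> width ?U * 1"
    by (intro mult_left_mono weak_ergodicity_le_1[OF T] width_nonneg[OF U])
  ultimately show ?thesis by simp
qed

text \<open>
  The rows of \<open>T ^^ n\<close> are the functionals of the chains that start from the point evaluations.
  This is what lets estimates for powers of \<open>T\<close> follow from estimates for chains.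
\<close>

lemma row_of_power: "(\<lambda>f. (T ^^ n) f x) = functional_at (\<lambda>f. f x) T n"
  by (simp add: functional_at_def comp_def)

lemma coherent_point_evaluation: "coherent (\<lambda>f. f x)"
  by (simp add: coherent_def)

lemma width_point_evaluation: "width (\<lambda>f. f x) = 0"
  using width_least[of "\<lambda>f. f x" 0] width_nonneg[OF coherent_point_evaluation, of x]
  by (simp add: lower_of_def)

lemma imprecision_power:
  fixes T :: "'a::finite operator"
  assumes T: "coherent_operator T"
  shows "imprecision (T ^^ n) \<le> real n * imprecision T"
proof (rule imprecision_least)
  fix x :: 'a
  show "width (\<lambda>f. (T ^^ n) f x) \<le> real n * imprecision T"
    unfolding row_of_power
  proof (induction n)
    case 0
    show ?case by (simp add: functional_at_0 width_point_evaluation)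
  next
    case (Suc n)
    then show ?case
      using width_step[OF coherent_point_evaluation T, of x n] by (simp add: algebra_simps)
  qed
qed

text \<open>
  The remainder \<open>m\<close> is spent first, at cost \<open>c\<close> per step, so its contribution is damped by all \<open>k\<close>
  contractions, while the contributions of the blocks of length \<open>r\<close> form a geometric series.
\<close>

lemma affine_recursion_bound:
  fixes J :: "nat \<Rightarrow> real"
  assumes step: "\<And>j. J (Suc j) \<le> J j + c"
    and contr: "\<And>j. J (j + r) \<le> J j * \<rho> + real r * c"
    and \<rho>: "0 \<le> \<rho>" "\<rho> < 1"
  shows "J (k * r + m) \<le> J 0 * \<rho> ^ k + c * (real r * ((1 - \<rho> ^ k) / (1 - \<rho>)) + real m * \<rho> ^ k)"
proof (induction k)
  case 0
  have "J m \<le> J 0 + c * real m"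
  proof (induction m)
    case (Suc m)
    then show ?case using step[of m] by (simp add: algebra_simps)
  qed simp
  then show ?case by simp
next
  case (Suc k)
  have "J (Suc k * r + m) = J (k * r + m + r)" by (simp add: ac_simps)
  also have "\<dots> \<le> J (k * r + m) * \<rho> + real r * c" by (rule contr)
  also have "\<dots> \<le> (J 0 * \<rho> ^ k + c * (real r * ((1 - \<rho> ^ k) / (1 - \<rho>)) + real m * \<rho> ^ k)) * \<rho>
      + real r * c"
    by (intro add_right_mono mult_right_mono Suc.IH \<rho>)
  also have "\<dots> = J 0 * \<rho> ^ Suc k
      + c * (real r * ((1 - \<rho> ^ k) / (1 - \<rho>) * \<rho> + 1) + real m * \<rho> ^ Suc k)"
    by (simp add: algebra_simps)
  also have "(1 - \<rho> ^ k) / (1 - \<rho>) * \<rho> + 1 = (1 - \<rho> ^ Suc k) / (1 - \<rho>)"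
    using \<rho> by (simp add: field_simps)
  finally show ?case .
qed

lemma width_bound:
  fixes T :: "'a::finite operator"
  assumes E: "coherent E" and T: "coherent_operator T"
    and \<rho>: "\<rho> = weak_ergodicity (T ^^ r)" "\<rho> < 1"
  shows "width (functional_at E T (k * r + m)) \<le> width E * \<rho> ^ k
      + imprecision T * (real r * ((1 - \<rho> ^ k) / (1 - \<rho>)) + real m * \<rho> ^ k)"
proof -
  have Tr: "coherent_operator (T ^^ r)" by (rule coherent_operator_power[OF T])
  have "width (functional_at E T (j + r))
      \<le> width (functional_at E T j) * \<rho> + real r * imprecision T" for j
    unfolding functional_at_add \<rho>(1)
    using width_comp[OF coherent_functional_at[OF E T] Tr, of j] imprecision_power[OF T, of r]
    by linarith
  moreover have "0 \<le> \<rho>" unfolding \<rho>(1) by (rule weak_ergodicity_nonneg[OF Tr])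
  ultimately show ?thesis
    using affine_recursion_bound[of "\<lambda>j. width (functional_at E T j)", OF width_step[OF E T]]
      \<rho>(2) by (simp add: functional_at_0)
qed

section \<open>The limit functionals\<close>

lemma oscillation_power:
  fixes T :: "'a::finite operator"
  assumes T: "coherent_operator T" and osc: "\<And>x y. f x - f y \<le> s"
  shows "(T ^^ (k * r)) f x - (T ^^ (k * r)) f y \<le> weak_ergodicity (T ^^ r) ^ k * s"
proof (induction k arbitrary: x y)
  case 0
  show ?case using osc by simp
next
  case (Suc k)
  show ?case
    using oscillation_contraction[OF coherent_operator_power[OF T], of "(T ^^ (k * r)) f" _ r x y, OF Suc.IH]
    by (simp add: funpow_add mult.assoc)
qed

text \<open>
  After time \<open>k * r\<close> all values lie between the extreme values of \<open>T ^^ (k * r)\<close> applied to \<open>f\<close>, whose difference decays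
  geometrically; so they form a Cauchy sequence.
\<close>

lemma functional_at_convergent:
  fixes T :: "'a::finite operator"
  assumes E: "coherent E" and T: "coherent_operator T" and \<rho>: "weak_ergodicity (T ^^ r) < 1"
  shows "convergent (\<lambda>n. functional_at E T n f)"
proof -
  let ?\<rho> = "weak_ergodicity (T ^^ r)"
  let ?s = "Max (range f) - Min (range f)"
  have osc: "f x - f y \<le> ?s" for x y by (intro diff_mono) simp_all
  have close: "\<bar>functional_at E T p f - functional_at E T q f\<bar> \<le> ?\<rho> ^ k * ?s"
    if "k * r \<le> p" "k * r \<le> q" for k p q
  proof -
    let ?g = "(T ^^ (k * r)) f"
    have between: "Min (range ?g) \<le> functional_at E T p f \<and>
        functional_at E T p f \<le> Max (range ?g)" if "k * r \<le> p" for p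
    proof -
      have "functional_at E T p f = functional_at E T (p - k * r) ?g"
        using functional_at_add[of E T "p - k * r" "k * r"] that by simp
      moreover have "Min (range ?g) \<le> ?g x" "?g x \<le> Max (range ?g)" for x by simp_all
      ultimately show ?thesis
        using coherent_le[OF coherent_functional_at[OF E T]]
          coherent_ge[OF coherent_functional_at[OF E T]] by metis
    qed
    obtain x y where "?g x = Max (range ?g)" "?g y = Min (range ?g)"
      using Max_in[of "range ?g"] Min_in[of "range ?g"] by fastforce
    then have "Max (range ?g) - Min (range ?g) \<le> ?\<rho> ^ k * ?s"
      using oscillation_power[OF T, of f ?s k r x y, OF osc] by simp
    then show ?thesis using between[OF that(1)] between[OF that(2)] by linarith
  qed
  have "Cauchy (\<lambda>n. functional_at E T n f)"
  proof (rule metric_CauchyI)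
    fix e :: real assume e: "0 < e"
    have "0 \<le> ?\<rho>" by (intro weak_ergodicity_nonneg coherent_operator_power T)
    then have "(\<lambda>k. ?\<rho> ^ k * ?s) \<longlonglongrightarrow> 0 * ?s" using \<rho> by (intro tendsto_intros LIMSEQ_realpow_zero)
    then have "eventually (\<lambda>k. ?\<rho> ^ k * ?s < e) sequentially"
      using e by (intro order_tendstoD(2)[of _ 0]) simp_all
    then obtain k where "?\<rho> ^ k * ?s < e" by (auto simp: eventually_sequentially)
    then show "\<exists>M. \<forall>p\<ge>M. \<forall>q\<ge>M. dist (functional_at E T p f) (functional_at E T q f) < e"
      using close[of k] by (intro exI[of _ "k * r"]) (auto simp: dist_real_def intro: le_less_trans)
  qed
  then show ?thesis by (simp add: Cauchy_convergent_iff)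
qed

lemma limit_distance_bound:
  fixes T :: "'a::finite operator"
  assumes E: "coherent E" and T: "coherent_operator T" and r: "1 \<le> r"
    and \<rho>: "weak_ergodicity (T ^^ r) < 1"
  shows "dist_upper_lower (functional_limit E T)
      (functional_limit (lower_of E) (lower_transition T))
    \<le> imprecision T * real r / (1 - weak_ergodicity (T ^^ r))"
  unfolding dist_upper_lower_def
proof (rule cSUP_least)
  show "(L1 :: ('a \<Rightarrow> real) set) \<noteq> {}" using zero_in_L1 by auto
  fix f :: "'a \<Rightarrow> real" assume f: "f \<in> L1"
  let ?\<rho> = "weak_ergodicity (T ^^ r)"
  let ?L = "functional_limit E T f - functional_limit (lower_of E) (lower_transition T) f"
  let ?b = "\<lambda>k. width E * ?\<rho> ^ k + imprecision T * (real r * ((1 - ?\<rho> ^ k) / (1 - ?\<rho>)))"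
  note conv = functional_at_convergent[OF E T \<rho>]
  have up: "(\<lambda>n. functional_at E T n f) \<longlonglongrightarrow> functional_limit E T f"
    unfolding functional_limit_def using conv convergent_LIMSEQ_iff by blast
  have "convergent (\<lambda>n. functional_at (lower_of E) (lower_transition T) n f)"
    unfolding functional_at_lower lower_of_def using conv by (simp add: convergent_minus_iff[symmetric])
  then have lo: "(\<lambda>n. functional_at (lower_of E) (lower_transition T) n f)
      \<longlonglongrightarrow> functional_limit (lower_of E) (lower_transition T) f"
    unfolding functional_limit_def using convergent_LIMSEQ_iff by blast
  \<comment> \<open>The limit is compared along the multiples of \<open>r\<close>, where the finite bound has no remainder term.\<close>
  have "filterlim (\<lambda>k. k * r) sequentially sequentially"
    using r by (intro filterlim_subseq strict_monoI) simp
  from filterlim_compose[OF tendsto_diff[OF up lo] this]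
  have lim: "(\<lambda>k. functional_at E T (k * r) f
      - functional_at (lower_of E) (lower_transition T) (k * r) f) \<longlonglongrightarrow> ?L" .
  have "0 \<le> ?\<rho>" by (intro weak_ergodicity_nonneg coherent_operator_power T)
  then have "?b \<longlonglongrightarrow> width E * 0 + imprecision T * (real r * ((1 - 0) / (1 - ?\<rho>)))"
    using \<rho> by (intro tendsto_intros LIMSEQ_realpow_zero) simp_all
  moreover have "functional_at E T (k * r) f
      - functional_at (lower_of E) (lower_transition T) (k * r) f \<le> ?b k" for k
    using width_upper[OF coherent_functional_at[OF E T, of "k * r"] f]
      width_bound[OF E T refl \<rho>, of k 0]
    by (simp add: functional_at_lower)
  ultimately have "?L \<le> width E * 0 + imprecision T * (real r * ((1 - 0) / (1 - ?\<rho>)))"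
    using lim by (intro LIMSEQ_le[OF lim]) auto
  then show "?L \<le> imprecision T * real r / (1 - ?\<rho>)" by simp
qed

section \<open>Bounds on the imprecision of a Markov chain\<close>

theorem corollary4:
  fixes E0 :: "'a::finite functional" and T :: "'a operator"
    and r k m n :: nat and \<rho> :: real
    and I Ihat :: "nat \<Rightarrow> real" and I_inf :: real
  assumes "is_upper_expectation E0"
    and "is_upper_transition T"
    and "r \<ge> 1"
    and "\<rho> = weak_ergodicity (T ^^ r)"
    and "\<rho> < 1"
    and "n = k * r + m"
    and "m < r"
    and "\<And>j. I j = dist_upper_lower (functional_at E0 T j)
                      (functional_at (lower_of E0) (lower_transition T) j)"
    and "\<And>j. Ihat j = dist_transition (T ^^ j) (lower_transition T ^^ j)"
    and "I_inf = dist_upper_lower (functional_limit E0 T)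
                   (functional_limit (lower_of E0) (lower_transition T))"
  shows "I n \<le> I 0 * \<rho> ^ k +
           Ihat 1 * (real r * ((1 - \<rho> ^ k) / (1 - \<rho>)) + real m * \<rho> ^ k)
       \<and> I_inf \<le> Ihat 1 * real r / (1 - \<rho>)
       \<and> Ihat n \<le> Ihat 1 * (real r * ((1 - \<rho> ^ k) / (1 - \<rho>)) + real m * \<rho> ^ k)"
proof -
  have E: "coherent E0" using assms(1) by (rule upper_expectation_coherent)
  have T: "coherent_operator T"
    using assms(2) upper_expectation_coherent
    by (auto simp: coherent_operator_def is_upper_transition_def)
  have I: "I j = width (functional_at E0 T j)" for j
    by (simp add: assms(8) functional_at_lower width_def)
  have Ihat: "Ihat j = imprecision (T ^^ j)" for j
    by (simp add: assms(9) lower_transition_power)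
  let ?B = "Ihat 1 * (real r * ((1 - \<rho> ^ k) / (1 - \<rho>)) + real m * \<rho> ^ k)"
  have "I n \<le> I 0 * \<rho> ^ k + ?B"
    using width_bound[OF E T assms(4,5), of k m] by (simp add: I Ihat assms(6) functional_at_0)
  moreover have "I_inf \<le> Ihat 1 * real r / (1 - \<rho>)"
    using limit_distance_bound[OF E T assms(3)] assms(4,5) by (simp add: Ihat assms(10))
  moreover have "Ihat n \<le> ?B"
    unfolding Ihat[of n]
  proof (rule imprecision_least)
    fix x :: 'a
    show "width (\<lambda>f. (T ^^ n) f x) \<le> ?B"
      using width_bound[OF coherent_point_evaluation T assms(4,5), of x k m]
      by (simp add: row_of_power width_point_evaluation Ihat assms(6))
  qed
  ultimately show ?thesis by blast
qed

end
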